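(* Let $\mathcal{T}$ be a triangulated category. If a map of triangles of the form $(1_X,g,h)$, from $X\xrightarrow{u}Y\xrightarrow{v}Z\xrightarrow{w}\Sigma X$ to $X\xrightarrow{u'}Y'\xrightarrow{v'}Z'\xrightarrow{w'}\Sigma X$, is good, then it is Verdier good.
   Context: $\mathcal{T}$ is a triangulated category with self-equivalence $\Sigma$. "Exact triangle" or "triangle" means distinguished triangle. A map of triangles $(f,g,h)$ from $X\xrightarrow{u}Y\xrightarrow{v}Z\xrightarrow{w}\Sigma X$ to $X'\xrightarrow{u'}Y'\xrightarrow{v'}Z'\xrightarrow{w'}\Sigma X'$ consists of $f\colon X\to X'$, $g\colon Y\to Y'$, $h\colon Z\to Z'$ with $gu=u'f$, $hv=v'g$, $(\Sigma f)w=w'h$. The mapping cone of $(f,g,h)$ is the sequence $X'\oplus Y\to Y'\oplus Z\to Z'\oplus\Sigma X\to\Sigma X'\oplus\Sigma Y$ with successive maps $\begin{bmatrix}u'&g\\0&-v\end{bmatrix},\begin{bmatrix}v'&h\\0&-w\end{bmatrix},\begin{bmatrix}w'&\Sigma f\\0&-\Sigma u\end{bmatrix}$ (acting on column vectors). $(f,g,h)$ is good if its mapping cone is an exact triangle. Octahedra: given composable maps $P\xrightarrow{a}Q\xrightarrow{b}R$ and exact triangles $P\xrightarrow{a}Q\xrightarrow{a'}C_a\xrightarrow{a''}\Sigma P$, $Q\xrightarrow{b}R\xrightarrow{b'}C_b\xrightarrow{b''}\Sigma Q$, $P\xrightarrow{ba}R\xrightarrow{c'}C\xrightarrow{c''}\Sigma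 P$, an octahedron for the composite $ba$ consists of maps $\alpha\colon C_a\to C$, $\beta\colon C\to C_b$, $\gamma\colon C_b\to\Sigma C_a$ such that $C_a\xrightarrow{\alpha}C\xrightarrow{\beta}C_b\xrightarrow{\gamma}\Sigma C_a$ is exact and $\alpha a'=c'b$, $c''\alpha=a''$, $\beta c'=b'$, $\gamma=(\Sigma a')b''$, $b''\beta=(\Sigma a)c''$. Verdier good: choose exact triangles $X\xrightarrow{f}X'\xrightarrow{f'}X''\xrightarrow{f''}\Sigma X$, $Y\xrightarrow{g}Y'\xrightarrow{g'}Y''\xrightarrow{g''}\Sigma Y$ and $X\xrightarrow{gu=u'f}Y'\xrightarrow{\tilde v}A\xrightarrow{\tilde w}\Sigma X$. The map $(f,g,h)$ is Verdier good if there exist an octahedron $(\alpha_1\colon Z\to A,\ \beta_1\colon A\to Y'',\ \gamma_1)$ for the composite $X\xrightarrow{u}Y\xrightarrow{g}Y'$ and an octahedron $(\alpha_2\colon X''\to A,\ \beta_2\colon A\to Z',\ \gamma_2)$ for the composite $X\xrightarrow{f}X'\xrightarrow{u'}Y'$ (both using the given and chosen triangles, in particular the same triangle on $gu=u'f$) such that $h=\beta_2\alpha_1$. This does not depend on the chosen triangles. *)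

theory Defs
  imports "HOL-Algebra.Group"
begin

record ('o, 'm) category =
  Obj :: "'o set"
  Arr :: "'m set"
  Dom :: "'m \<Rightarrow> 'o"
  Cod :: "'m \<Rightarrow> 'o"
  ident :: "'o \<Rightarrow> 'm"
  Comp :: "'m \<Rightarrow> 'm \<Rightarrow> 'm"  (infixl "\<cdot>\<index>" 70)

definition Hom :: "('o, 'm, 'x) category_scheme \<Rightarrow> 'o \<Rightarrow> 'o \<Rightarrow> 'm set" where
  "Hom C X Y = {f \<in> Arr C. Dom C f = X \<and> Cod C f = Y}"

locale category =
  fixes C :: "('o, 'm, 'x) category_scheme" (structure)
  assumes Dom_in: "f \<in> Arr C \<Longrightarrow> Dom C f \<in> Obj C"
    and Cod_in: "f \<in> Arr C \<Longrightarrow> Cod C f \<in> Obj C"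
    and ident_in: "X \<in> Obj C \<Longrightarrow> ident C X \<in> Hom C X X"
    and Comp_in: "\<lbrakk>f \<in> Hom C X Y; g \<in> Hom C Y Z\<rbrakk> \<Longrightarrow> g \<cdot> f \<in> Hom C X Z"
    and Comp_assoc: "\<lbrakk>f \<in> Hom C W X; g \<in> Hom C X Y; h \<in> Hom C Y Z\<rbrakk> \<Longrightarrow> h \<cdot> g \<cdot> f = h \<cdot> (g \<cdot> f)"
    and ident_left: "f \<in> Hom C X Y \<Longrightarrow> ident C Y \<cdot> f = f"
    and ident_right: "f \<in> Hom C X Y \<Longrightarrow> f \<cdot> ident C X = f"

definition is_iso :: "('o, 'm, 'x) category_scheme \<Rightarrow> 'm \<Rightarrow> bool" where
  "is_iso C f \<longleftrightarrow> f \<in> Arr C \<and>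
     (\<exists>g \<in> Hom C (Cod C f) (Dom C f).
        g \<cdot>\<^bsub>C\<^esub> f = ident C (Dom C f) \<and> f \<cdot>\<^bsub>C\<^esub> g = ident C (Cod C f))"

definition is_functor ::
    "('o, 'm, 'x) category_scheme \<Rightarrow> ('p, 'n, 'y) category_scheme \<Rightarrow> ('o \<Rightarrow> 'p) \<Rightarrow> ('m \<Rightarrow> 'n) \<Rightarrow> bool" where
  "is_functor C D FO FM \<longleftrightarrow>
     (\<forall>X \<in> Obj C. FO X \<in> Obj D \<and> FM (ident C X) = ident D (FO X)) \<and>
     (\<forall>X Y. \<forall>f \<in> Hom C X Y. FM f \<in> Hom D (FO X) (FO Y)) \<and>
     (\<forall>X Y Z. \<forall>f \<in> Hom C X Y. \<forall>g \<in> Hom C Y Z. FM (g \<cdot>\<^bsub>C\<^esub> f) = FM g \<cdot>\<^bsub>D\<^esub> FM f)"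

definition is_nat_iso ::
    "('o, 'm, 'x) category_scheme \<Rightarrow> ('p, 'n, 'y) category_scheme \<Rightarrow>
     ('o \<Rightarrow> 'p) \<Rightarrow> ('m \<Rightarrow> 'n) \<Rightarrow> ('o \<Rightarrow> 'p) \<Rightarrow> ('m \<Rightarrow> 'n) \<Rightarrow> ('o \<Rightarrow> 'n) \<Rightarrow> bool" where
  "is_nat_iso C D FO FM GO GM \<eta> \<longleftrightarrow>
     (\<forall>X \<in> Obj C. \<eta> X \<in> Hom D (FO X) (GO X) \<and> is_iso D (\<eta> X)) \<and>
     (\<forall>X Y. \<forall>f \<in> Hom C X Y. \<eta> Y \<cdot>\<^bsub>D\<^esub> FM f = GM f \<cdot>\<^bsub>D\<^esub> \<eta> X)"

definition self_equivalence ::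
    "('o, 'm, 'x) category_scheme \<Rightarrow> ('o \<Rightarrow> 'o) \<Rightarrow> ('m \<Rightarrow> 'm) \<Rightarrow> bool" where
  "self_equivalence C FO FM \<longleftrightarrow> is_functor C C FO FM \<and>
     (\<exists>GO GM \<eta> \<epsilon>. is_functor C C GO GM \<and>
        is_nat_iso C C (\<lambda>X. X) (\<lambda>f. f) (\<lambda>X. GO (FO X)) (\<lambda>f. GM (FM f)) \<eta> \<and>
        is_nat_iso C C (\<lambda>X. FO (GO X)) (\<lambda>f. FM (GM f)) (\<lambda>X. X) (\<lambda>f. f) \<epsilon>)"

record ('o, 'm) additive_category = "('o, 'm) category" +
  Zero :: "'o \<Rightarrow> 'o \<Rightarrow> 'm"
  Add :: "'m \<Rightarrow> 'm \<Rightarrow> 'm"  (infixl "\<boxplus>\<index>" 65)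

definition Hom_group :: "('o, 'm, 'x) additive_category_scheme \<Rightarrow> 'o \<Rightarrow> 'o \<Rightarrow> 'm monoid" where
  "Hom_group C X Y = \<lparr>carrier = Hom C X Y, monoid.mult = Add C, one = Zero C X Y\<rparr>"

definition Neg :: "('o, 'm, 'x) additive_category_scheme \<Rightarrow> 'm \<Rightarrow> 'm"  ("\<boxminus>\<index> _" [81] 80) where
  "Neg C f = inv\<^bsub>Hom_group C (Dom C f) (Cod C f)\<^esub> f"

definition zero_object :: "('o, 'm, 'x) category_scheme \<Rightarrow> 'o \<Rightarrow> bool" where
  "zero_object C Z \<longleftrightarrow> Z \<in> Obj C \<and>
     (\<forall>X \<in> Obj C. (\<exists>!f. f \<in> Hom C X Z) \<and> (\<exists>!f. f \<in> Hom C Z X))"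

definition biproduct ::
    "('o, 'm, 'x) additive_category_scheme \<Rightarrow> 'o \<Rightarrow> 'o \<Rightarrow> 'o \<Rightarrow> 'm \<Rightarrow> 'm \<Rightarrow> 'm \<Rightarrow> 'm \<Rightarrow> bool" where
  "biproduct C A B S i\<^sub>1 i\<^sub>2 p\<^sub>1 p\<^sub>2 \<longleftrightarrow>
     i\<^sub>1 \<in> Hom C A S \<and> i\<^sub>2 \<in> Hom C B S \<and> p\<^sub>1 \<in> Hom C S A \<and> p\<^sub>2 \<in> Hom C S B \<and>
     p\<^sub>1 \<cdot>\<^bsub>C\<^esub> i\<^sub>1 = ident C A \<and> p\<^sub>2 \<cdot>\<^bsub>C\<^esub> i\<^sub>2 = ident C B \<and>
     p\<^sub>1 \<cdot>\<^bsub>C\<^esub> i\<^sub>2 = Zero C B A \<and> p\<^sub>2 \<cdot>\<^bsub>C\<^esub> i\<^sub>1 = Zero C A B \<and>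
     i\<^sub>1 \<cdot>\<^bsub>C\<^esub> p\<^sub>1 \<boxplus>\<^bsub>C\<^esub> i\<^sub>2 \<cdot>\<^bsub>C\<^esub> p\<^sub>2 = ident C S"

text \<open>The map between two biproducts given by the matrix with rows \<open>a b\<close> and \<open>c d\<close>,
  acting on column vectors: \<open>p\<^sub>1, p\<^sub>2\<close> are the projections of the source and
  \<open>j\<^sub>1, j\<^sub>2\<close> the injections of the target.\<close>

definition matrix_map ::
    "('o, 'm, 'x) additive_category_scheme \<Rightarrow> 'm \<Rightarrow> 'm \<Rightarrow> 'm \<Rightarrow> 'm \<Rightarrow> 'm \<Rightarrow> 'm \<Rightarrow> 'm \<Rightarrow> 'm \<Rightarrow> 'm" where
  "matrix_map C p\<^sub>1 p\<^sub>2 j\<^sub>1 j\<^sub>2 a b c d =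
     j\<^sub>1 \<cdot>\<^bsub>C\<^esub> (a \<cdot>\<^bsub>C\<^esub> p\<^sub>1 \<boxplus>\<^bsub>C\<^esub> b \<cdot>\<^bsub>C\<^esub> p\<^sub>2) \<boxplus>\<^bsub>C\<^esub> j\<^sub>2 \<cdot>\<^bsub>C\<^esub> (c \<cdot>\<^bsub>C\<^esub> p\<^sub>1 \<boxplus>\<^bsub>C\<^esub> d \<cdot>\<^bsub>C\<^esub> p\<^sub>2)"

locale additive_category = category C
  for C :: "('o, 'm, 'x) additive_category_scheme" (structure) +
  assumes Hom_comm_group: "\<lbrakk>X \<in> Obj C; Y \<in> Obj C\<rbrakk> \<Longrightarrow> comm_group (Hom_group C X Y)"
    and Comp_Add_left:
      "\<lbrakk>f \<in> Hom C X Y; g \<in> Hom C Y Z; h \<in> Hom C Y Z\<rbrakk> \<Longrightarrow> (g \<boxplus> h) \<cdot> f = g \<cdot> f \<boxplus> h \<cdot> f"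
    and Comp_Add_right:
      "\<lbrakk>f \<in> Hom C X Y; g \<in> Hom C X Y; h \<in> Hom C Y Z\<rbrakk> \<Longrightarrow> h \<cdot> (f \<boxplus> g) = h \<cdot> f \<boxplus> h \<cdot> g"
    and zero_object_exists: "\<exists>Z. zero_object C Z"
    and biproduct_exists:
      "\<lbrakk>A \<in> Obj C; B \<in> Obj C\<rbrakk> \<Longrightarrow> \<exists>S i\<^sub>1 i\<^sub>2 p\<^sub>1 p\<^sub>2. biproduct C A B S i\<^sub>1 i\<^sub>2 p\<^sub>1 p\<^sub>2"

text \<open>\<open>SuspO\<close> and \<open>Susp\<close> are the action of the suspension on objects and on arrows.  A triple
  \<open>(u, v, w)\<close> in \<open>Tri\<close> stands for the exact triangle with these three successive maps; its
  objects are determined by the maps.\<close>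

record ('o, 'm) triangulated_category = "('o, 'm) additive_category" +
  SuspO :: "'o \<Rightarrow> 'o"
  Susp :: "'m \<Rightarrow> 'm"
  Tri :: "('m \<times> 'm \<times> 'm) set"

definition candidate_triangle ::
    "('o, 'm, 'x) triangulated_category_scheme \<Rightarrow> 'o \<Rightarrow> 'o \<Rightarrow> 'o \<Rightarrow> 'm \<Rightarrow> 'm \<Rightarrow> 'm \<Rightarrow> bool" where
  "candidate_triangle T X Y Z u v w \<longleftrightarrow>
     u \<in> Hom T X Y \<and> v \<in> Hom T Y Z \<and> w \<in> Hom T Z (SuspO T X)"

definition exact_triangle ::
    "('o, 'm, 'x) triangulated_category_scheme \<Rightarrow> 'o \<Rightarrow> 'o \<Rightarrow> 'o \<Rightarrow> 'm \<Rightarrow> 'm \<Rightarrow> 'm \<Rightarrow> bool" where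
  "exact_triangle T X Y Z u v w \<longleftrightarrow> candidate_triangle T X Y Z u v w \<and> (u, v, w) \<in> Tri T"

definition triangle_map ::
    "('o, 'm, 'x) triangulated_category_scheme \<Rightarrow> 'm \<times> 'm \<times> 'm \<Rightarrow> 'm \<times> 'm \<times> 'm \<Rightarrow> 'm \<times> 'm \<times> 'm \<Rightarrow> bool" where
  "triangle_map T = (\<lambda>(u, v, w) (u', v', w') (f, g, h).
     f \<in> Hom T (Dom T u) (Dom T u') \<and> g \<in> Hom T (Dom T v) (Dom T v') \<and>
     h \<in> Hom T (Dom T w) (Dom T w') \<and>
     g \<cdot>\<^bsub>T\<^esub> u = u' \<cdot>\<^bsub>T\<^esub> f \<and> h \<cdot>\<^bsub>T\<^esub> v = v' \<cdot>\<^bsub>T\<^esub> g \<and> Susp T f \<cdot>\<^bsub>T\<^esub> w = w' \<cdot>\<^bsub>T\<^esub> h)"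

text \<open>\<open>octahedron T (a, a', a'') (b, b', b'') (c', c'') (\<alpha>, \<beta>, \<gamma>)\<close>: the maps \<open>\<alpha>, \<beta>, \<gamma>\<close> form an
  octahedron for the composite \<open>b a\<close>, relative to exact triangles \<open>(a, a', a'')\<close>,
  \<open>(b, b', b'')\<close> and \<open>(b a, c', c'')\<close>.\<close>

definition octahedron ::
    "('o, 'm, 'x) triangulated_category_scheme \<Rightarrow> 'm \<times> 'm \<times> 'm \<Rightarrow> 'm \<times> 'm \<times> 'm \<Rightarrow> 'm \<times> 'm \<Rightarrow>
     'm \<times> 'm \<times> 'm \<Rightarrow> bool" where
  "octahedron T = (\<lambda>(a, a', a'') (b, b', b'') (c', c'') (\<alpha>, \<beta>, \<gamma>).
     exact_triangle T (Cod T a') (Cod T c') (Cod T b') \<alpha> \<beta> \<gamma> \<and>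
     \<alpha> \<cdot>\<^bsub>T\<^esub> a' = c' \<cdot>\<^bsub>T\<^esub> b \<and> c'' \<cdot>\<^bsub>T\<^esub> \<alpha> = a'' \<and> \<beta> \<cdot>\<^bsub>T\<^esub> c' = b' \<and>
     \<gamma> = Susp T a' \<cdot>\<^bsub>T\<^esub> b'' \<and> b'' \<cdot>\<^bsub>T\<^esub> \<beta> = Susp T a \<cdot>\<^bsub>T\<^esub> c'')"

locale triangulated_category = additive_category T
  for T :: "('o, 'm, 'x) triangulated_category_scheme" (structure) +
  assumes Susp_equivalence: "self_equivalence T (SuspO T) (Susp T)"
    and Susp_Add: "\<lbrakk>f \<in> Hom T X Y; g \<in> Hom T X Y\<rbrakk> \<Longrightarrow> Susp T (f \<boxplus> g) = Susp T f \<boxplus> Susp T g"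
    and Tri_candidate: "(u, v, w) \<in> Tri T \<Longrightarrow> \<exists>X Y Z. candidate_triangle T X Y Z u v w"
    and TR1_iso:
      "\<lbrakk>exact_triangle T X Y Z u v w; candidate_triangle T X' Y' Z' u' v' w';
        triangle_map T (u, v, w) (u', v', w') (f, g, h); is_iso T f; is_iso T g; is_iso T h\<rbrakk>
       \<Longrightarrow> exact_triangle T X' Y' Z' u' v' w'"
    and TR1_ident:
      "\<lbrakk>X \<in> Obj T; zero_object T Z\<rbrakk>
       \<Longrightarrow> exact_triangle T X X Z (ident T X) (Zero T X Z) (Zero T Z (SuspO T X))"
    and TR1_complete: "u \<in> Hom T X Y \<Longrightarrow> \<exists>Z v w. exact_triangle T X Y Z u v w"
    and TR2:
      "candidate_triangle T X Y Z u v w \<Longrightarrow>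
       exact_triangle T X Y Z u v w \<longleftrightarrow> exact_triangle T Y Z (SuspO T X) v w (\<boxminus> Susp T u)"
    and TR3:
      "\<lbrakk>exact_triangle T X Y Z u v w; exact_triangle T X' Y' Z' u' v' w';
        f \<in> Hom T X X'; g \<in> Hom T Y Y'; g \<cdot> u = u' \<cdot> f\<rbrakk>
       \<Longrightarrow> \<exists>h. triangle_map T (u, v, w) (u', v', w') (f, g, h)"
    and TR4:
      "\<lbrakk>exact_triangle T P Q C\<^sub>a a a' a''; exact_triangle T Q R C\<^sub>b b b' b'';
        exact_triangle T P R C\<^sub>c (b \<cdot> a) c' c''\<rbrakk>
       \<Longrightarrow> \<exists>\<alpha> \<beta> \<gamma>. octahedron T (a, a', a'') (b, b', b'') (c', c'') (\<alpha>, \<beta>, \<gamma>)"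

text \<open>In the mapping cone, \<open>\<Sigma>X' \<oplus> \<Sigma>Y\<close> is identified with \<open>\<Sigma>(X' \<oplus> Y)\<close> as usual: the suspended
  injections of \<open>X' \<oplus> Y\<close> serve as the injections of the target of the last map.  Exact
  triangles being closed under isomorphism, the choice of the three biproducts is
  immaterial for \<open>good\<close>.\<close>

definition good ::
    "('o, 'm, 'x) triangulated_category_scheme \<Rightarrow> 'm \<times> 'm \<times> 'm \<Rightarrow> 'm \<times> 'm \<times> 'm \<Rightarrow> 'm \<times> 'm \<times> 'm \<Rightarrow> bool" where
  "good T = (\<lambda>(u, v, w) (u', v', w') (f, g, h).
     let X = Dom T u; Y = Dom T v; Z = Dom T w; X' = Dom T u'; Y' = Dom T v'; Z' = Dom T w' in
     \<exists>S\<^sub>1 i\<^sub>1 i\<^sub>2 p\<^sub>1 p\<^sub>2 S\<^sub>2 j\<^sub>1 j\<^sub>2 q\<^sub>1 q\<^sub>2 S\<^sub>3 k\<^sub>1 k\<^sub>2 r\<^sub>1 r\<^sub>2.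
       biproduct T X' Y S\<^sub>1 i\<^sub>1 i\<^sub>2 p\<^sub>1 p\<^sub>2 \<and>
       biproduct T Y' Z S\<^sub>2 j\<^sub>1 j\<^sub>2 q\<^sub>1 q\<^sub>2 \<and>
       biproduct T Z' (SuspO T X) S\<^sub>3 k\<^sub>1 k\<^sub>2 r\<^sub>1 r\<^sub>2 \<and>
       exact_triangle T S\<^sub>1 S\<^sub>2 S\<^sub>3
         (matrix_map T p\<^sub>1 p\<^sub>2 j\<^sub>1 j\<^sub>2
            u'            g
            (Zero T X' Z) (\<boxminus>\<^bsub>T\<^esub> v))
         (matrix_map T q\<^sub>1 q\<^sub>2 k\<^sub>1 k\<^sub>2
            v'                      h
            (Zero T Y' (SuspO T X)) (\<boxminus>\<^bsub>T\<^esub> w))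
         (matrix_map T r\<^sub>1 r\<^sub>2 (Susp T i\<^sub>1) (Susp T i\<^sub>2)
            w'                      (Susp T f)
            (Zero T Z' (SuspO T Y)) (\<boxminus>\<^bsub>T\<^esub> Susp T u)))"

text \<open>The notion is independent of the exact triangles chosen on \<open>f\<close>, \<open>g\<close> and \<open>g u = u' f\<close>
  (which exist by \<open>TR1_complete\<close>); we require the octahedra for every choice.  Both octahedra
  refer to the same triangle \<open>(g u, vt, wt)\<close>.\<close>

definition Verdier_good ::
    "('o, 'm, 'x) triangulated_category_scheme \<Rightarrow> 'm \<times> 'm \<times> 'm \<Rightarrow> 'm \<times> 'm \<times> 'm \<Rightarrow> 'm \<times> 'm \<times> 'm \<Rightarrow> bool" where
  "Verdier_good T = (\<lambda>(u, v, w) (u', v', w') (f, g, h).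
     \<forall>X'' f' f'' Y'' g' g'' A vt wt.
       exact_triangle T (Dom T f) (Cod T f) X'' f f' f'' \<and>
       exact_triangle T (Dom T g) (Cod T g) Y'' g g' g'' \<and>
       exact_triangle T (Dom T u) (Cod T g) A (g \<cdot>\<^bsub>T\<^esub> u) vt wt \<longrightarrow>
       (\<exists>\<alpha>\<^sub>1 \<beta>\<^sub>1 \<gamma>\<^sub>1 \<alpha>\<^sub>2 \<beta>\<^sub>2 \<gamma>\<^sub>2.
          octahedron T (u, v, w) (g, g', g'') (vt, wt) (\<alpha>\<^sub>1, \<beta>\<^sub>1, \<gamma>\<^sub>1) \<and>
          octahedron T (f, f', f'') (u', v', w') (vt, wt) (\<alpha>\<^sub>2, \<beta>\<^sub>2, \<gamma>\<^sub>2) \<and>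
          h = \<beta>\<^sub>2 \<cdot>\<^bsub>T\<^esub> \<alpha>\<^sub>1))"

end

theory Submission imports Defs begin

text \<open>Splitting the contractible summand on \<open>X\<close> off the mapping cone of \<open>(1, g, h)\<close> leaves an exact
  triangle \<open>Y \<rightarrow> Y' \<oplus> Z \<rightarrow> Z' \<rightarrow> \<Sigma>Y\<close> with last map \<open>\<Sigma>u w'\<close>. The octahedral axiom for
  \<open>Y \<rightarrow> Y' \<oplus> Z \<rightarrow> Y'\<close>, whose composite is \<open>g\<close>, then yields an exact triangle
  \<open>Z \<rightarrow> Z' \<rightarrow> Y'' \<rightarrow> \<Sigma>Z\<close> starting with \<open>h\<close>, which is an octahedron for \<open>g u\<close> if \<open>Z'\<close> is taken
  as the cone of \<open>g u = u'\<close>. An arbitrary cone \<open>A\<close> is compared with \<open>Z'\<close> through an octahedron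
  for \<open>u' 1\<close>: its middle map \<open>\<beta>\<^sub>2\<close> is invertible because the cone of \<open>1\<close> vanishes, and
  \<open>\<alpha>\<^sub>1 = \<beta>\<^sub>2\<^sup>-\<^sup>1 h\<close>.\<close>

section \<open>Arrows, composition and isomorphisms in a category\<close>

context category
begin

text \<open>Membership in \<open>Hom\<close> is traded for conditions on \<open>Arr\<close>,
  \<open>Dom\<close> and \<open>Cod\<close>, which the simplifier computes for composites; the
  typing rules and the law \<open>assoc\<close> below are phrased accordingly.\<close>

lemma Hom_iff: "f \<in> Hom C X Y \<longleftrightarrow> f \<in> Arr C \<and> Dom C f = X \<and> Cod C f = Y"
  by (simp add: Hom_def)

lemmas Dom_in [simp] and Cod_in [simp]

lemma ident_simps [simp]:
  assumes "X \<in> Obj C"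
  shows "ident C X \<in> Arr C" "Dom C (ident C X) = X" "Cod C (ident C X) = X"
  using ident_in[OF assms] by (auto simp: Hom_iff)

lemma Comp_simps [simp]:
  assumes "f \<in> Arr C" "g \<in> Arr C" "Cod C f = Dom C g"
  shows "g \<cdot> f \<in> Arr C" "Dom C (g \<cdot> f) = Dom C f" "Cod C (g \<cdot> f) = Cod C g"
  using Comp_in[of f "Dom C f" "Dom C g" g "Cod C g"] assms by (auto simp: Hom_iff)

lemma assoc:
  "\<lbrakk>f \<in> Arr C; g \<in> Arr C; h \<in> Arr C; Cod C f = Dom C g; Cod C g = Dom C h\<rbrakk>
    \<Longrightarrow> h \<cdot> g \<cdot> f = h \<cdot> (g \<cdot> f)"
  by (rule Comp_assoc) (auto simp: Hom_iff)

lemma ident_Comp [simp]: "\<lbrakk>f \<in> Arr C; Cod C f = Y\<rbrakk> \<Longrightarrow> ident C Y \<cdot> f = f"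
  by (rule ident_left) (auto simp: Hom_iff)

lemma Comp_ident [simp]: "\<lbrakk>f \<in> Arr C; Dom C f = X\<rbrakk> \<Longrightarrow> f \<cdot> ident C X = f"
  by (rule ident_right) (auto simp: Hom_iff)

lemma is_isoI:
  assumes "f \<in> Hom C X Y" "g \<in> Hom C Y X" "g \<cdot> f = ident C X" "f \<cdot> g = ident C Y"
  shows "is_iso C f"
  using assms unfolding is_iso_def by (auto simp: Hom_iff)

lemma is_isoE:
  assumes "is_iso C f" "f \<in> Hom C X Y"
  obtains g where "g \<in> Hom C Y X" "g \<cdot> f = ident C X" "f \<cdot> g = ident C Y"
  using assms unfolding is_iso_def by (auto simp: Hom_iff)

lemma is_iso_ident: "X \<in> Obj C \<Longrightarrow> is_iso C (ident C X)"
  by (rule is_isoI[of _ X X "ident C X"]) (auto simp: Hom_iff)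

end

section \<open>Addition, signs and zero maps\<close>

context additive_category
begin

lemma Zero_simps [simp]:
  assumes "X \<in> Obj C" "Y \<in> Obj C"
  shows "Zero C X Y \<in> Arr C" "Dom C (Zero C X Y) = X" "Cod C (Zero C X Y) = Y"
proof -
  interpret comm_group "Hom_group C X Y" using Hom_comm_group assms .
  show "Zero C X Y \<in> Arr C" "Dom C (Zero C X Y) = X" "Cod C (Zero C X Y) = Y"
    using one_closed by (auto simp: Hom_group_def Hom_iff)
qed

lemma Add_simps [simp]:
  assumes "f \<in> Arr C" "g \<in> Arr C" "Dom C f = Dom C g" "Cod C f = Cod C g"
  shows "f \<boxplus> g \<in> Arr C" "Dom C (f \<boxplus> g) = Dom C g" "Cod C (f \<boxplus> g) = Cod C g"
proof -
  interpret comm_group "Hom_group C (Dom C g) (Cod C g)" using Hom_comm_group assms by simp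
  show "f \<boxplus> g \<in> Arr C" "Dom C (f \<boxplus> g) = Dom C g" "Cod C (f \<boxplus> g) = Cod C g"
    using m_closed[of f g] assms by (auto simp: Hom_group_def Hom_iff)
qed

lemma Neg_simps [simp]:
  assumes "f \<in> Arr C"
  shows "\<boxminus> f \<in> Arr C" "Dom C (\<boxminus> f) = Dom C f" "Cod C (\<boxminus> f) = Cod C f"
    "\<boxminus> f \<boxplus> f = Zero C (Dom C f) (Cod C f)" "f \<boxplus> \<boxminus> f = Zero C (Dom C f) (Cod C f)"
    "\<boxminus> (\<boxminus> f) = f"
proof -
  interpret comm_group "Hom_group C (Dom C f) (Cod C f)" using Hom_comm_group assms by simp
  have f: "f \<in> carrier (Hom_group C (Dom C f) (Cod C f))"
    using assms by (simp add: Hom_group_def Hom_iff)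
  show n: "\<boxminus> f \<in> Arr C" "Dom C (\<boxminus> f) = Dom C f" "Cod C (\<boxminus> f) = Cod C f"
    using inv_closed[OF f] by (auto simp: Hom_group_def Hom_iff Neg_def)
  show "\<boxminus> f \<boxplus> f = Zero C (Dom C f) (Cod C f)" "f \<boxplus> \<boxminus> f = Zero C (Dom C f) (Cod C f)"
    using l_inv[OF f] r_inv[OF f] by (auto simp: Hom_group_def Neg_def)
  show "\<boxminus> (\<boxminus> f) = f"
    using inv_inv[OF f] n by (simp add: Neg_def)
qed

lemma Add_Zero [simp]:
  assumes "f \<in> Arr C" "Dom C f = X" "Cod C f = Y"
  shows "f \<boxplus> Zero C X Y = f" "Zero C X Y \<boxplus> f = f"
proof -
  interpret comm_group "Hom_group C (Dom C f) (Cod C f)"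
    by (rule Hom_comm_group) (use assms in auto)
  show "f \<boxplus> Zero C X Y = f" "Zero C X Y \<boxplus> f = f"
    using r_one[of f] l_one[of f] assms by (auto simp: Hom_group_def Hom_iff)
qed

lemma Add_commute:
  assumes "f \<in> Arr C" "g \<in> Arr C" "Dom C f = Dom C g" "Cod C f = Cod C g"
  shows "f \<boxplus> g = g \<boxplus> f"
proof -
  interpret comm_group "Hom_group C (Dom C f) (Cod C f)" using Hom_comm_group assms by simp
  show ?thesis
    using m_comm[of f g] assms by (auto simp: Hom_group_def Hom_iff)
qed

lemma Add_assoc:
  assumes "f \<in> Arr C" "g \<in> Arr C" "h \<in> Arr C" "Dom C f = Dom C g" "Cod C f = Cod C g"
    "Dom C g = Dom C h" "Cod C g = Cod C h"
  shows "f \<boxplus> g \<boxplus> h = f \<boxplus> (g \<boxplus> h)"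
proof -
  interpret comm_group "Hom_group C (Dom C f) (Cod C f)" using Hom_comm_group assms by simp
  show ?thesis
    using m_assoc[of f g h] assms by (auto simp: Hom_group_def Hom_iff)
qed

lemma Add_left_cancel:
  assumes "f \<in> Arr C" "g \<in> Arr C" "h \<in> Arr C" "Dom C f = Dom C g" "Cod C f = Cod C g"
    "Dom C g = Dom C h" "Cod C g = Cod C h" "f \<boxplus> g = f \<boxplus> h"
  shows "g = h"
proof -
  interpret comm_group "Hom_group C (Dom C f) (Cod C f)" using Hom_comm_group assms by simp
  show ?thesis
    using Units_l_cancel[of f g h] assms unfolding Units_eq by (auto simp: Hom_group_def Hom_iff)
qed

text \<open>Uniqueness of inverses: signs are moved past composition and past the suspension by
  checking that a sum vanishes.\<close>

lemma eq_Neg_if_Add_eq_Zero: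
  assumes "f \<in> Arr C" "g \<in> Arr C" "Dom C f = Dom C g" "Cod C f = Cod C g"
    "f \<boxplus> g = Zero C (Dom C g) (Cod C g)"
  shows "g = \<boxminus> f"
  by (rule Add_left_cancel[of f]) (use assms in auto)

lemma Neg_Zero [simp]: "\<lbrakk>X \<in> Obj C; Y \<in> Obj C\<rbrakk> \<Longrightarrow> \<boxminus> Zero C X Y = Zero C X Y"
  by (rule eq_Neg_if_Add_eq_Zero[symmetric]) auto

lemma eq_Zero_if_Neg_eq_Zero:
  assumes "f \<in> Arr C" "Dom C f = X" "Cod C f = Y" "\<boxminus> f = Zero C X Y"
  shows "f = Zero C X Y"
proof -
  have "X \<in> Obj C" "Y \<in> Obj C" using assms by auto
  then show ?thesis using Neg_simps(6)[OF assms(1)] assms(4) by simp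
qed

lemma Comp_Add:
  assumes "f \<in> Arr C" "g \<in> Arr C" "h \<in> Arr C"
    "Dom C f = Dom C g" "Cod C f = Cod C g" "Cod C g = Dom C h"
  shows "h \<cdot> (f \<boxplus> g) = h \<cdot> f \<boxplus> h \<cdot> g"
  by (rule Comp_Add_right) (use assms in \<open>auto simp: Hom_iff\<close>)

lemma Add_Comp:
  assumes "f \<in> Arr C" "g \<in> Arr C" "h \<in> Arr C"
    "Dom C g = Dom C h" "Cod C g = Cod C h" "Cod C f = Dom C h"
  shows "(g \<boxplus> h) \<cdot> f = g \<cdot> f \<boxplus> h \<cdot> f"
  by (rule Comp_Add_left) (use assms in \<open>auto simp: Hom_iff\<close>)

lemma Comp_Zero [simp]:
  assumes "f \<in> Arr C" "X \<in> Obj C" "Dom C f = Y"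
  shows "f \<cdot> Zero C X Y = Zero C X (Cod C f)"
proof (rule Add_left_cancel[of "f \<cdot> Zero C X Y"])
  have "Y \<in> Obj C" using assms by auto
  then show "f \<cdot> Zero C X Y \<boxplus> f \<cdot> Zero C X Y = f \<cdot> Zero C X Y \<boxplus> Zero C X (Cod C f)"
    using assms Comp_Add[of "Zero C X Y" "Zero C X Y" f] by simp
qed (use assms in auto)

lemma Zero_Comp [simp]:
  assumes "f \<in> Arr C" "Z \<in> Obj C" "Cod C f = Y"
  shows "Zero C Y Z \<cdot> f = Zero C (Dom C f) Z"
proof (rule Add_left_cancel[of "Zero C Y Z \<cdot> f"])
  have "Y \<in> Obj C" using assms by auto
  then show "Zero C Y Z \<cdot> f \<boxplus> Zero C Y Z \<cdot> f = Zero C Y Z \<cdot> f \<boxplus> Zero C (Dom C f) Z"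
    using assms Add_Comp[of f "Zero C Y Z" "Zero C Y Z"] by simp
qed (use assms in auto)

lemma Comp_Neg:
  assumes "f \<in> Arr C" "g \<in> Arr C" "Cod C f = Dom C g"
  shows "g \<cdot> \<boxminus> f = \<boxminus> (g \<cdot> f)"
  by (rule eq_Neg_if_Add_eq_Zero) (use assms in \<open>auto simp: Comp_Add[symmetric]\<close>)

lemma Neg_Comp:
  assumes "f \<in> Arr C" "g \<in> Arr C" "Cod C f = Dom C g"
  shows "\<boxminus> g \<cdot> f = \<boxminus> (g \<cdot> f)"
  by (rule eq_Neg_if_Add_eq_Zero) (use assms in \<open>auto simp: Add_Comp[symmetric]\<close>)

lemma to_zero_object:
  assumes "zero_object C Z" "f \<in> Arr C" "Cod C f = Z"
  shows "f = Zero C (Dom C f) Z"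
proof -
  have "\<exists>!g. g \<in> Hom C (Dom C f) Z"
    using assms unfolding zero_object_def by auto
  moreover have "f \<in> Hom C (Dom C f) Z" "Zero C (Dom C f) Z \<in> Hom C (Dom C f) Z"
    using assms by (auto simp: Hom_iff)
  ultimately show ?thesis by blast
qed

text \<open>Every map into or out of \<open>Z\<close> is its composite with the identity of
  \<open>Z\<close>, hence a composite with zero.\<close>

lemma zero_objectI:
  assumes "Z \<in> Obj C" "ident C Z = Zero C Z Z"
  shows "zero_object C Z"
  unfolding zero_object_def
proof (intro conjI ballI)
  fix X assume X: "X \<in> Obj C"
  have "f = Zero C X Z" if "f \<in> Hom C X Z" for f
    using that assms ident_Comp[of f Z] Zero_Comp[of f Z Z] by (auto simp: Hom_iff)
  then show "\<exists>!f. f \<in> Hom C X Z"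
    using X assms(1) by (intro ex1I[of _ "Zero C X Z"]) (auto simp: Hom_iff)
  have "f = Zero C Z X" if "f \<in> Hom C Z X" for f
    using that assms Comp_ident[of f Z] Comp_Zero[of f Z Z] by (auto simp: Hom_iff)
  then show "\<exists>!f. f \<in> Hom C Z X"
    using X assms(1) by (intro ex1I[of _ "Zero C Z X"]) (auto simp: Hom_iff)
qed (rule assms(1))

end

section \<open>The suspension as a faithful additive functor\<close>

context triangulated_category
begin

lemma Susp_functor: "is_functor T T (SuspO T) (Susp T)"
  using Susp_equivalence unfolding self_equivalence_def by blast

lemma SuspO_in [simp]: "X \<in> Obj T \<Longrightarrow> SuspO T X \<in> Obj T"
  and Susp_ident [simp]: "X \<in> Obj T \<Longrightarrow> Susp T (ident T X) = ident T (SuspO T X)"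
  using Susp_functor unfolding is_functor_def by auto

lemma Susp_simps [simp]:
  assumes "f \<in> Arr T"
  shows "Susp T f \<in> Arr T" "Dom T (Susp T f) = SuspO T (Dom T f)"
    "Cod T (Susp T f) = SuspO T (Cod T f)"
  using Susp_functor assms unfolding is_functor_def by (auto simp: Hom_iff)

lemma Susp_Comp:
  assumes "f \<in> Arr T" "g \<in> Arr T" "Cod T f = Dom T g"
  shows "Susp T (g \<cdot> f) = Susp T g \<cdot> Susp T f"
  using Susp_functor assms unfolding is_functor_def by (auto simp: Hom_iff)

lemma Susp_Zero [simp]:
  assumes "X \<in> Obj T" "Y \<in> Obj T"
  shows "Susp T (Zero T X Y) = Zero T (SuspO T X) (SuspO T Y)"
proof (rule Add_left_cancel[of "Susp T (Zero T X Y)"])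
  show "Susp T (Zero T X Y) \<boxplus> Susp T (Zero T X Y)
      = Susp T (Zero T X Y) \<boxplus> Zero T (SuspO T X) (SuspO T Y)"
    using assms Susp_Add[of "Zero T X Y" X Y "Zero T X Y"] by (simp add: Hom_iff)
qed (use assms in auto)

lemma Susp_Neg:
  assumes "f \<in> Arr T"
  shows "Susp T (\<boxminus> f) = \<boxminus> Susp T f"
  by (rule eq_Neg_if_Add_eq_Zero)
    (use assms Susp_Add[of f "Dom T f" "Cod T f" "\<boxminus> f"] in \<open>auto simp: Hom_iff\<close>)

text \<open>A quasi-inverse recovers \<open>f\<close> from \<open>Susp T f\<close> up to the natural
  isomorphism \<eta>, whose component at \<open>Y\<close> can be cancelled on the left.\<close>

lemma Susp_faithful:
  assumes "f \<in> Hom T X Y" "g \<in> Hom T X Y" "Susp T f = Susp T g"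
  shows "f = g"
proof -
  obtain GO GM \<eta> where
    nat: "is_nat_iso T T (\<lambda>X. X) (\<lambda>f. f) (\<lambda>X. GO (SuspO T X)) (\<lambda>f. GM (Susp T f)) \<eta>"
    using Susp_equivalence unfolding self_equivalence_def by blast
  have "Y \<in> Obj T" using assms(1) by (auto simp: Hom_iff)
  then have iso: "is_iso T (\<eta> Y)" "\<eta> Y \<in> Hom T Y (GO (SuspO T Y))"
    using nat unfolding is_nat_iso_def by auto
  then obtain e where e: "e \<in> Hom T (GO (SuspO T Y)) Y" "e \<cdot> \<eta> Y = ident T Y"
    by (rule is_isoE)
  have "\<eta> Y \<cdot> f = \<eta> Y \<cdot> g"
    using nat assms unfolding is_nat_iso_def by metis
  then have "e \<cdot> \<eta> Y \<cdot> f = e \<cdot> \<eta> Y \<cdot> g"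
    using assms e(1) iso by (simp add: Hom_iff assoc)
  then show ?thesis
    using assms e by (simp add: Hom_iff)
qed

section \<open>Consequences of the axioms for exact triangles\<close>

lemma exact_triangleD:
  assumes "exact_triangle T X Y Z u v w"
  shows "u \<in> Arr T" "Dom T u = X" "Cod T u = Y" "v \<in> Arr T" "Dom T v = Y" "Cod T v = Z"
    "w \<in> Arr T" "Dom T w = Z" "Cod T w = SuspO T X" "X \<in> Obj T" "Y \<in> Obj T" "Z \<in> Obj T"
  using assms unfolding exact_triangle_def candidate_triangle_def by (auto simp: Hom_iff)

lemma rotate:
  assumes "exact_triangle T X Y Z u v w"
  shows "exact_triangle T Y Z (SuspO T X) v w (\<boxminus> Susp T u)"
  using TR2 assms unfolding exact_triangle_def by blast

text \<open>By \<open>TR3\<close> the pair \<open>(1, u)\<close> extends to a map from the triangle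
  on the identity of \<open>X\<close>, so \<open>v \<cdot> u\<close> factors through a zero object.
  The other two relations follow by rotation, the last one up to a sign.\<close>

lemma exact_Comp_Zero:
  assumes "exact_triangle T X Y Z u v w"
  shows "v \<cdot> u = Zero T X Z" "w \<cdot> v = Zero T Y (SuspO T X)" "Susp T u \<cdot> w = Zero T Z (SuspO T Y)"
proof -
  have vu: "v \<cdot> u = Zero T X Z" if t: "exact_triangle T X Y Z u v w" for X Y Z u v w
  proof -
    note D = exact_triangleD[OF t]
    obtain N where N: "zero_object T N" using zero_object_exists by blast
    then have "exact_triangle T X X N (ident T X) (Zero T X N) (Zero T N (SuspO T X))"
      using D by (intro TR1_ident)
    from TR3[OF this t, of "ident T X" u] obtain h where
      "triangle_map T (ident T X, Zero T X N, Zero T N (SuspO T X)) (u, v, w) (ident T X, u, h)"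
      using D by (auto simp: Hom_iff)
    moreover have "N \<in> Obj T" using N by (simp add: zero_object_def)
    ultimately have "h \<in> Hom T N Z" "h \<cdot> Zero T X N = v \<cdot> u"
      using D by (simp_all add: triangle_map_def)
    then show ?thesis using D by (simp add: Hom_iff)
  qed
  note D = exact_triangleD[OF assms]
  show "v \<cdot> u = Zero T X Z" using vu assms .
  show "w \<cdot> v = Zero T Y (SuspO T X)" using vu rotate[OF assms] .
  have "\<boxminus> (Susp T u \<cdot> w) = Zero T Z (SuspO T Y)"
    using vu[OF rotate[OF rotate[OF assms]]] D by (simp add: Neg_Comp)
  then show "Susp T u \<cdot> w = Zero T Z (SuspO T Y)"
    by (rule eq_Zero_if_Neg_eq_Zero[rotated -1]) (use D in auto)
qed

text \<open>The pair \<open>(0, f)\<close> maps the triangle to \<open>N \<rightarrow> W = W\<close>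
  with \<open>N\<close> a zero object; the third component supplied by \<open>TR3\<close> extends
  \<open>f\<close> along \<open>v\<close>.\<close>

lemma weak_cokernel:
  assumes t: "exact_triangle T X Y Z u v w" and f: "f \<in> Hom T Y W" and fu: "f \<cdot> u = Zero T X W"
  obtains g where "g \<in> Hom T Z W" "g \<cdot> v = f"
proof -
  note D = exact_triangleD[OF t]
  have W: "W \<in> Obj T" using f by (auto simp: Hom_iff)
  obtain N where N: "zero_object T N" using zero_object_exists by blast
  then have NO: "N \<in> Obj T" by (simp add: zero_object_def)
  \<comment> \<open>\<open>TR1_ident\<close> gives a triangle beginning with \<open>W = W\<close>.
    To rotate it back to one starting at \<open>N\<close>, its third object has to be the suspension
    of \<open>N\<close>, so that suspension must again be a zero object.\<close>
  have "ident T N = Zero T N N" using to_zero_object[OF N, of "ident T N"] NO by simp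
  then have "ident T (SuspO T N) = Zero T (SuspO T N) (SuspO T N)"
    using NO by (metis Susp_ident Susp_Zero)
  then have "zero_object T (SuspO T N)" using NO by (intro zero_objectI) auto
  then have "exact_triangle T W W (SuspO T N) (ident T W) (Zero T W (SuspO T N))
      (Zero T (SuspO T N) (SuspO T W))"
    using W by (intro TR1_ident)
  moreover have "candidate_triangle T N W W (Zero T N W) (ident T W) (Zero T W (SuspO T N))"
    using W NO by (simp add: candidate_triangle_def Hom_iff)
  ultimately have "exact_triangle T N W W (Zero T N W) (ident T W) (Zero T W (SuspO T N))"
    using TR2 W NO by simp
  from TR3[OF t this, of "Zero T X N" f] obtain h where
    "triangle_map T (u, v, w) (Zero T N W, ident T W, Zero T W (SuspO T N)) (Zero T X N, f, h)"
    using D f fu W NO by (auto simp: Hom_iff)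
  then have "h \<in> Hom T Z W" "h \<cdot> v = f"
    using D f W NO by (auto simp: triangle_map_def Hom_iff)
  then show ?thesis by (rule that)
qed

text \<open>The difference of \<open>f\<close> and \<open>g\<close> vanishes on \<open>v\<close>, so
  it factors through \<open>w\<close> by \<open>weak_cokernel\<close> for the rotated
  triangle.\<close>

lemma eq_up_to_third_map:
  assumes t: "exact_triangle T X Y Z u v w" and f: "f \<in> Hom T Z W" "g \<in> Hom T Z W"
    and eq: "f \<cdot> v = g \<cdot> v"
  obtains s where "s \<in> Hom T (SuspO T X) W" "f = g \<boxplus> s \<cdot> w"
proof -
  note D = exact_triangleD[OF t]
  have "(f \<boxplus> \<boxminus> g) \<cdot> v = Zero T Y W"
    using D f eq by (simp add: Hom_iff Add_Comp Neg_Comp)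
  moreover have "f \<boxplus> \<boxminus> g \<in> Hom T Z W" using f by (simp add: Hom_iff)
  ultimately obtain s where s: "s \<in> Hom T (SuspO T X) W" "s \<cdot> w = f \<boxplus> \<boxminus> g"
    using weak_cokernel[OF rotate[OF t]] by blast
  have "g \<boxplus> s \<cdot> w = g \<boxplus> (\<boxminus> g \<boxplus> f)"
    using f s(2) Add_commute[of f "\<boxminus> g"] by (simp add: Hom_iff)
  also have "\<dots> = f" using f by (auto simp: Hom_iff Add_assoc[symmetric])
  finally show ?thesis using that[OF s(1)] by simp
qed

text \<open>As \<open>u = 0\<close>, the identity of \<open>Y\<close> extends along \<open>v\<close>
  to a left inverse \<open>r\<close>. Then \<open>v \<cdot> r\<close> and the identity agree after
  \<open>v\<close>, so they differ by a multiple of \<open>w = 0\<close>.\<close>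

lemma second_map_iso:
  assumes t: "exact_triangle T X Y Z u v w"
    and u: "u = Zero T X Y" and w: "w = Zero T Z (SuspO T X)"
  shows "is_iso T v"
proof -
  note D = exact_triangleD[OF t]
  obtain r where r: "r \<in> Hom T Z Y" "r \<cdot> v = ident T Y"
    using weak_cokernel[OF t, of "ident T Y" Y] D u by (auto simp: Hom_iff)
  have "v \<cdot> r \<cdot> v = ident T Z \<cdot> v"
    using D r by (simp add: Hom_iff assoc)
  then obtain s where s: "s \<in> Hom T (SuspO T X) Z" "v \<cdot> r = ident T Z \<boxplus> s \<cdot> w"
    using eq_up_to_third_map[OF t, of "v \<cdot> r" Z "ident T Z"] D r by (auto simp: Hom_iff)
  then have "v \<cdot> r = ident T Z" using D w by (simp add: Hom_iff)
  then show ?thesis using r D by (intro is_isoI[of v Y Z r]) (auto simp: Hom_iff)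
qed

section \<open>Biproducts, their split triangles and matrices\<close>

lemma biproductD:
  assumes "biproduct T A B S i\<^sub>1 i\<^sub>2 p\<^sub>1 p\<^sub>2"
  shows "i\<^sub>1 \<in> Arr T" "Dom T i\<^sub>1 = A" "Cod T i\<^sub>1 = S" "i\<^sub>2 \<in> Arr T" "Dom T i\<^sub>2 = B" "Cod T i\<^sub>2 = S"
    "p\<^sub>1 \<in> Arr T" "Dom T p\<^sub>1 = S" "Cod T p\<^sub>1 = A" "p\<^sub>2 \<in> Arr T" "Dom T p\<^sub>2 = S" "Cod T p\<^sub>2 = B"
    "A \<in> Obj T" "B \<in> Obj T" "S \<in> Obj T"
    "p\<^sub>1 \<cdot> i\<^sub>1 = ident T A" "p\<^sub>2 \<cdot> i\<^sub>2 = ident T B" "p\<^sub>1 \<cdot> i\<^sub>2 = Zero T B A" "p\<^sub>2 \<cdot> i\<^sub>1 = Zero T A B"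
    "i\<^sub>1 \<cdot> p\<^sub>1 \<boxplus> i\<^sub>2 \<cdot> p\<^sub>2 = ident T S"
  using assms unfolding biproduct_def by (auto simp: Hom_iff)

text \<open>Any cone \<open>C\<close> of the split monomorphism \<open>i\<^sub>2\<close> has zero
  connecting map \<open>d\<close>: the suspension of \<open>i\<^sub>2\<close> is split mono and
  kills \<open>d\<close>. Extending \<open>p\<^sub>1\<close> along \<open>c\<close> then identifies
  \<open>C\<close> with \<open>A\<close>.\<close>

lemma split_triangle:
  assumes b: "biproduct T A B S i\<^sub>1 i\<^sub>2 p\<^sub>1 p\<^sub>2"
  shows "exact_triangle T B S A i\<^sub>2 p\<^sub>1 (Zero T A (SuspO T B))"
proof -
  note B = biproductD[OF b]
  obtain C c d where t: "exact_triangle T B S C i\<^sub>2 c d"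
    using TR1_complete[of i\<^sub>2 B S] B by (auto simp: Hom_iff)
  note D = exact_triangleD[OF t]
  note Z = exact_Comp_Zero[OF t]
  have "d = Susp T (p\<^sub>2 \<cdot> i\<^sub>2) \<cdot> d" using B D by simp
  also have "\<dots> = Susp T p\<^sub>2 \<cdot> (Susp T i\<^sub>2 \<cdot> d)"
    using B(1-15) D by (simp add: Susp_Comp assoc)
  finally have d: "d = Zero T C (SuspO T B)" using Z B D by simp
  obtain \<phi> where \<phi>: "\<phi> \<in> Hom T C A" "\<phi> \<cdot> c = p\<^sub>1"
    using weak_cokernel[OF t, of p\<^sub>1 A] B by (auto simp: Hom_iff)
  have 1: "\<phi> \<cdot> (c \<cdot> i\<^sub>1) = ident T A"
    using \<phi> B D assoc[of i\<^sub>1 c \<phi>] by (simp add: Hom_iff)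
  \<comment> \<open>The added summand is zero because \<open>c \<cdot> i\<^sub>2 = 0\<close>; it
    completes the decomposition of the identity of \<open>S\<close>.\<close>
  have "c \<cdot> i\<^sub>1 \<cdot> \<phi> \<cdot> c = c \<cdot> (i\<^sub>1 \<cdot> p\<^sub>1) \<boxplus> c \<cdot> i\<^sub>2 \<cdot> p\<^sub>2"
    using \<phi> B D Z by (simp add: Hom_iff assoc)
  also have "\<dots> = c \<cdot> (i\<^sub>1 \<cdot> p\<^sub>1 \<boxplus> i\<^sub>2 \<cdot> p\<^sub>2)"
    using B(1-15) D by (simp add: Comp_Add assoc)
  also have "\<dots> = ident T C \<cdot> c" using B D by simp
  finally obtain s where s: "s \<in> Hom T (SuspO T B) C" "c \<cdot> i\<^sub>1 \<cdot> \<phi> = ident T C \<boxplus> s \<cdot> d"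
    using eq_up_to_third_map[OF t, of "c \<cdot> i\<^sub>1 \<cdot> \<phi>" C "ident T C"] B D \<phi> by (auto simp: Hom_iff)
  then have "c \<cdot> i\<^sub>1 \<cdot> \<phi> = ident T C" using D d by (simp add: Hom_iff)
  then have iso: "is_iso T \<phi>"
    using 1 \<phi> B D by (intro is_isoI[of \<phi> C A "c \<cdot> i\<^sub>1"]) (auto simp: Hom_iff)
  show ?thesis
    by (rule TR1_iso[OF t, of _ _ _ _ _ _ "ident T B" "ident T S" \<phi>])
      (use B D \<phi> iso d in \<open>auto simp: Hom_iff candidate_triangle_def triangle_map_def is_iso_ident\<close>)
qed

text \<open>This makes the last map of a mapping cone, whose target is the suspension of the first
  biproduct, accessible to the matrix rules.\<close>

lemma biproduct_Susp:
  assumes b: "biproduct T A B S i\<^sub>1 i\<^sub>2 p\<^sub>1 p\<^sub>2"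
  shows "biproduct T (SuspO T A) (SuspO T B) (SuspO T S)
    (Susp T i\<^sub>1) (Susp T i\<^sub>2) (Susp T p\<^sub>1) (Susp T p\<^sub>2)"
proof -
  note B = biproductD[OF b]
  have "Susp T (i\<^sub>1 \<cdot> p\<^sub>1 \<boxplus> i\<^sub>2 \<cdot> p\<^sub>2) = Susp T (i\<^sub>1 \<cdot> p\<^sub>1) \<boxplus> Susp T (i\<^sub>2 \<cdot> p\<^sub>2)"
    using B(1-15) by (intro Susp_Add[of _ S S]) (auto simp: Hom_iff)
  then have "Susp T (i\<^sub>1 \<cdot> p\<^sub>1) \<boxplus> Susp T (i\<^sub>2 \<cdot> p\<^sub>2) = ident T (SuspO T S)"
    using B by simp
  then show ?thesis
    using B unfolding biproduct_def by (simp add: Susp_Comp[symmetric] Hom_iff)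
qed

lemma matrix_map_simps:
  assumes b: "biproduct T A B S i\<^sub>1 i\<^sub>2 p\<^sub>1 p\<^sub>2" and b': "biproduct T A' B' S' j\<^sub>1 j\<^sub>2 q\<^sub>1 q\<^sub>2"
    and "a \<in> Hom T A A'" "b \<in> Hom T B A'" "c \<in> Hom T A B'" "d \<in> Hom T B B'"
  defines "m \<equiv> matrix_map T p\<^sub>1 p\<^sub>2 j\<^sub>1 j\<^sub>2 a b c d"
  shows "m \<in> Hom T S S'" "q\<^sub>1 \<cdot> m = a \<cdot> p\<^sub>1 \<boxplus> b \<cdot> p\<^sub>2" "q\<^sub>2 \<cdot> m = c \<cdot> p\<^sub>1 \<boxplus> d \<cdot> p\<^sub>2"
    "m \<cdot> i\<^sub>1 = j\<^sub>1 \<cdot> a \<boxplus> j\<^sub>2 \<cdot> c" "m \<cdot> i\<^sub>2 = j\<^sub>1 \<cdot> b \<boxplus> j\<^sub>2 \<cdot> d"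
proof -
  note B = biproductD[OF b] and B' = biproductD[OF b']
  show "m \<in> Hom T S S'" using B B' assms(3-6) by (simp add: m_def matrix_map_def Hom_iff)
  have s: "a \<cdot> p\<^sub>1 \<boxplus> b \<cdot> p\<^sub>2 \<in> Hom T S A'" "c \<cdot> p\<^sub>1 \<boxplus> d \<cdot> p\<^sub>2 \<in> Hom T S B'"
    using B B' assms(3-6) by (simp_all add: Hom_iff)
  show "q\<^sub>1 \<cdot> m = a \<cdot> p\<^sub>1 \<boxplus> b \<cdot> p\<^sub>2" "q\<^sub>2 \<cdot> m = c \<cdot> p\<^sub>1 \<boxplus> d \<cdot> p\<^sub>2"
    using B B' s by (simp_all add: m_def matrix_map_def Hom_iff Comp_Add assoc[symmetric])
  show "m \<cdot> i\<^sub>1 = j\<^sub>1 \<cdot> a \<boxplus> j\<^sub>2 \<cdot> c" "m \<cdot> i\<^sub>2 = j\<^sub>1 \<cdot> b \<boxplus> j\<^sub>2 \<cdot> d"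
    using B B' assms(3-6)
    by (simp_all add: m_def matrix_map_def Hom_iff Add_Comp Comp_Add assoc)
qed

section \<open>Splitting the mapping cone and reading off the octahedron on \<open>h\<close>\<close>

text \<open>The octahedron for \<open>Y \<rightarrow> X \<oplus> Y \<rightarrow> Y' \<oplus> Z\<close> gives a cone \<open>C\<close> of the composite as the
  kernel of the split epimorphism \<open>(w', 1) : Z' \<oplus> \<Sigma>X \<rightarrow> \<Sigma>X\<close>, hence \<open>C \<cong> Z'\<close>.\<close>

lemma column_row_triangle:
  assumes t: "exact_triangle T X Y Z u v w" and t': "exact_triangle T X Y' Z' u' v' w'"
    and m: "triangle_map T (u, v, w) (u', v', w') (ident T X, g, h)"
    and good: "good T (u, v, w) (u', v', w') (ident T X, g, h)"
  obtains S j\<^sub>1 j\<^sub>2 q\<^sub>1 q\<^sub>2 where "biproduct T Y' Z S j\<^sub>1 j\<^sub>2 q\<^sub>1 q\<^sub>2"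
    "exact_triangle T Y S Z' (j\<^sub>1 \<cdot> g \<boxplus> j\<^sub>2 \<cdot> (\<boxminus> v)) (v' \<cdot> q\<^sub>1 \<boxplus> h \<cdot> q\<^sub>2) (Susp T u \<cdot> w')"
proof -
  note D = exact_triangleD[OF t] and D' = exact_triangleD[OF t']
  have gh: "g \<in> Arr T" "Dom T g = Y" "Cod T g = Y'" "h \<in> Arr T" "Dom T h = Z" "Cod T h = Z'"
    using m D D' by (auto simp: triangle_map_def Hom_iff)
  from good obtain S\<^sub>1 i\<^sub>1 i\<^sub>2 p\<^sub>1 p\<^sub>2 S\<^sub>2 j\<^sub>1 j\<^sub>2 q\<^sub>1 q\<^sub>2 S\<^sub>3 k\<^sub>1 k\<^sub>2 r\<^sub>1 r\<^sub>2 d\<^sub>1 d\<^sub>2 d\<^sub>3 where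
    b1: "biproduct T X Y S\<^sub>1 i\<^sub>1 i\<^sub>2 p\<^sub>1 p\<^sub>2" and
    b2: "biproduct T Y' Z S\<^sub>2 j\<^sub>1 j\<^sub>2 q\<^sub>1 q\<^sub>2" and
    b3: "biproduct T Z' (SuspO T X) S\<^sub>3 k\<^sub>1 k\<^sub>2 r\<^sub>1 r\<^sub>2" and
    d1: "d\<^sub>1 = matrix_map T p\<^sub>1 p\<^sub>2 j\<^sub>1 j\<^sub>2 u' g (Zero T X Z) (\<boxminus> v)" and
    d2: "d\<^sub>2 = matrix_map T q\<^sub>1 q\<^sub>2 k\<^sub>1 k\<^sub>2 v' h (Zero T Y' (SuspO T X)) (\<boxminus> w)" and
    d3: "d\<^sub>3 = matrix_map T r\<^sub>1 r\<^sub>2 (Susp T i\<^sub>1) (Susp T i\<^sub>2) w' (Susp T (ident T X))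
      (Zero T Z' (SuspO T Y)) (\<boxminus> Susp T u)" and
    cone: "exact_triangle T S\<^sub>1 S\<^sub>2 S\<^sub>3 d\<^sub>1 d\<^sub>2 d\<^sub>3"
    using D D' by (auto simp: good_def Let_def)
  note B1 = biproductD[OF b1] and B2 = biproductD[OF b2] and B3 = biproductD[OF b3]
  note E = exact_triangleD[OF cone]
  have d1i2: "d\<^sub>1 \<cdot> i\<^sub>2 = j\<^sub>1 \<cdot> g \<boxplus> j\<^sub>2 \<cdot> (\<boxminus> v)"
    unfolding d1 by (rule matrix_map_simps[OF b1 b2]) (use D D' gh in \<open>auto simp: Hom_iff\<close>)
  have r1d2: "r\<^sub>1 \<cdot> d\<^sub>2 = v' \<cdot> q\<^sub>1 \<boxplus> h \<cdot> q\<^sub>2"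
    unfolding d2 by (rule matrix_map_simps[OF b2 b3]) (use D D' gh in \<open>auto simp: Hom_iff\<close>)
  have "Susp T p\<^sub>1 \<cdot> d\<^sub>3 = w' \<cdot> r\<^sub>1 \<boxplus> Susp T (ident T X) \<cdot> r\<^sub>2"
    unfolding d3 by (rule matrix_map_simps[OF b3 biproduct_Susp[OF b1]])
      (use D D' in \<open>auto simp: Hom_iff\<close>)
  then have p1d3: "Susp T p\<^sub>1 \<cdot> d\<^sub>3 = w' \<cdot> r\<^sub>1 \<boxplus> r\<^sub>2" using D B3 by simp
  have "Susp T p\<^sub>2 \<cdot> d\<^sub>3 = Zero T Z' (SuspO T Y) \<cdot> r\<^sub>1 \<boxplus> (\<boxminus> Susp T u) \<cdot> r\<^sub>2"
    unfolding d3 by (rule matrix_map_simps[OF b3 biproduct_Susp[OF b1]])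
      (use D D' in \<open>auto simp: Hom_iff\<close>)
  then have p2d3: "Susp T p\<^sub>2 \<cdot> d\<^sub>3 = \<boxminus> (Susp T u \<cdot> r\<^sub>2)" using D D' B3 by (simp add: Neg_Comp)
  obtain C c' c'' where tc: "exact_triangle T Y S\<^sub>2 C (d\<^sub>1 \<cdot> i\<^sub>2) c' c''"
    using TR1_complete[of "d\<^sub>1 \<cdot> i\<^sub>2" Y S\<^sub>2] B1 B2 E by (auto simp: Hom_iff)
  note F = exact_triangleD[OF tc]
  \<comment> \<open>The cone of \<open>i\<^sub>2\<close> is \<open>X\<close> by
    \<open>split_triangle\<close>. The third map \<gamma> of the octahedron is the first row of
    \<open>d\<^sub>3\<close>, that is, \<open>(w', 1)\<close>.\<close>
  obtain \<alpha> \<beta> \<gamma> where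
    "octahedron T (i\<^sub>2, p\<^sub>1, Zero T X (SuspO T Y)) (d\<^sub>1, d\<^sub>2, d\<^sub>3) (c', c'') (\<alpha>, \<beta>, \<gamma>)"
    using TR4[OF split_triangle[OF b1] cone tc] by blast
  then have o: "exact_triangle T X C S\<^sub>3 \<alpha> \<beta> \<gamma>" "\<beta> \<cdot> c' = d\<^sub>2" "d\<^sub>3 \<cdot> \<beta> = Susp T i\<^sub>2 \<cdot> c''"
    "\<gamma> = w' \<cdot> r\<^sub>1 \<boxplus> r\<^sub>2"
    using B1 E F p1d3 by (auto simp: octahedron_def)
  note G = exact_triangleD[OF o(1)]
  note OZ = exact_Comp_Zero[OF o(1)]
  \<comment> \<open>The injection \<open>k\<^sub>2\<close> is a section of \<gamma>, while the
    suspension of \<alpha> composed with \<gamma> is zero.\<close>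
  have "Susp T \<alpha> = Susp T \<alpha> \<cdot> (\<gamma> \<cdot> k\<^sub>2)"
    using B3 G D' by (simp add: o(4) Add_Comp assoc)
  also have "\<dots> = Susp T (Zero T X C)"
    using B3(1-15) G OZ by (simp add: assoc[symmetric])
  finally have \<alpha>: "\<alpha> = Zero T X C"
    by (rule Susp_faithful[of \<alpha> X C, rotated -1]) (use G in \<open>auto simp: Hom_iff\<close>)
  obtain \<rho> where \<rho>: "\<rho> \<in> Hom T S\<^sub>3 C" "\<rho> \<cdot> \<beta> = ident T C"
    using weak_cokernel[OF o(1), of "ident T C" C] G \<alpha> by (auto simp: Hom_iff)
  have "\<beta> \<cdot> \<rho> \<cdot> \<beta> = ident T S\<^sub>3 \<cdot> \<beta>"
    using \<rho> G by (simp add: Hom_iff assoc)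
  then obtain \<sigma> where \<sigma>: "\<sigma> \<in> Hom T (SuspO T X) S\<^sub>3" "\<beta> \<cdot> \<rho> = ident T S\<^sub>3 \<boxplus> \<sigma> \<cdot> \<gamma>"
    using eq_up_to_third_map[OF o(1), of "\<beta> \<cdot> \<rho>" S\<^sub>3 "ident T S\<^sub>3"] \<rho> G by (auto simp: Hom_iff)
  \<comment> \<open>\<psi> is the column \<open>(1, -w')\<close>, the evident inclusion of
    \<open>Z'\<close> into the kernel of \<gamma>. It is to satisfy
    \<open>\<psi> \<cdot> \<phi> = \<beta>\<close>, which makes \<open>\<rho> \<cdot> \<psi>\<close>
    the inverse of \<phi>.\<close>
  define \<phi> where "\<phi> = r\<^sub>1 \<cdot> \<beta>"
  define \<psi> where "\<psi> = k\<^sub>1 \<boxplus> k\<^sub>2 \<cdot> (\<boxminus> w')"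
  have \<phi>: "\<phi> \<in> Arr T" "Dom T \<phi> = C" "Cod T \<phi> = Z'"
    using B3 G by (simp_all add: \<phi>_def)
  have \<psi>: "\<psi> \<in> Arr T" "Dom T \<psi> = Z'" "Cod T \<psi> = S\<^sub>3"
    using B3 D' by (simp_all add: \<psi>_def)
  have "w' \<cdot> \<phi> \<boxplus> r\<^sub>2 \<cdot> \<beta> = Zero T C (SuspO T X)"
    using OZ(2) B3(1-15) G D' by (simp add: o(4) \<phi>_def Add_Comp assoc)
  then have r2\<beta>: "r\<^sub>2 \<cdot> \<beta> = \<boxminus> (w' \<cdot> \<phi>)"
    by (intro eq_Neg_if_Add_eq_Zero) (use B3 G D' \<phi> in auto)
  have "\<beta> = (k\<^sub>1 \<cdot> r\<^sub>1 \<boxplus> k\<^sub>2 \<cdot> r\<^sub>2) \<cdot> \<beta>" using B3 G by simp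
  also have "\<dots> = k\<^sub>1 \<cdot> \<phi> \<boxplus> k\<^sub>2 \<cdot> (\<boxminus> (w' \<cdot> \<phi>))"
    using B3(1-15) G r2\<beta> by (simp add: \<phi>_def Add_Comp assoc)
  also have "\<dots> = \<psi> \<cdot> \<phi>"
    using B3(1-15) D' \<phi> by (simp add: \<psi>_def Add_Comp Neg_Comp assoc)
  finally have \<psi>\<phi>: "\<psi> \<cdot> \<phi> = \<beta>" by simp
  have r\<psi>: "r\<^sub>1 \<cdot> \<psi> = ident T Z'" "r\<^sub>2 \<cdot> \<psi> = \<boxminus> w'"
    using B3 D' by (simp_all add: \<psi>_def Comp_Add assoc[symmetric])
  have \<gamma>\<psi>: "\<gamma> \<cdot> \<psi> = Zero T Z' (SuspO T X)"
    using B3 D' \<psi> r\<psi> by (simp add: o(4) Add_Comp assoc)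
  have "\<phi> \<cdot> (\<rho> \<cdot> \<psi>) = r\<^sub>1 \<cdot> (\<beta> \<cdot> \<rho> \<cdot> \<psi>)"
    using \<rho>(1) B3(1-15) G \<psi> by (simp add: \<phi>_def Hom_iff assoc)
  \<comment> \<open>\<open>\<beta> \<cdot> \<rho>\<close> differs from the identity by a multiple of
    \<gamma>, and \<gamma> kills \<psi>.\<close>
  also have "\<beta> \<cdot> \<rho> \<cdot> \<psi> = \<psi>"
    using \<sigma> G D' \<psi> \<gamma>\<psi> by (simp add: Hom_iff Add_Comp assoc)
  finally have 1: "\<phi> \<cdot> (\<rho> \<cdot> \<psi>) = ident T Z'" using r\<psi> by simp
  have "\<rho> \<cdot> \<psi> \<cdot> \<phi> = ident T C"
    using \<rho> \<psi> \<phi> \<psi>\<phi> by (simp add: Hom_iff assoc)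
  with 1 have iso: "is_iso T \<phi>"
    using \<rho> \<phi> \<psi> by (intro is_isoI[of \<phi> C Z' "\<rho> \<cdot> \<psi>"]) (auto simp: Hom_iff)
  have \<phi>c': "\<phi> \<cdot> c' = v' \<cdot> q\<^sub>1 \<boxplus> h \<cdot> q\<^sub>2"
    using B3(1-15) G F o(2) r1d2 by (simp add: \<phi>_def assoc)
  \<comment> \<open>The second row of \<open>d\<^sub>3\<close> recovers \<open>c''\<close> from
    \<open>d\<^sub>3 \<cdot> \<beta>\<close>. The sign in that row cancels the sign in
    \<open>r\<^sub>2 \<cdot> \<beta> = - w' \<cdot> \<phi>\<close>.\<close>
  have "c'' = Susp T (p\<^sub>2 \<cdot> i\<^sub>2) \<cdot> c''" using B1 F by simp
  also have "\<dots> = Susp T p\<^sub>2 \<cdot> (d\<^sub>3 \<cdot> \<beta>)"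
    using B1(1-15) F o(3) by (simp add: Susp_Comp assoc)
  also have "\<dots> = \<boxminus> (Susp T u \<cdot> (r\<^sub>2 \<cdot> \<beta>))"
    using B1(1-15) B3(1-15) E G D p2d3 by (simp add: assoc[symmetric] Neg_Comp)
  also have "\<dots> = Susp T u \<cdot> w' \<cdot> \<phi>"
    using D D' \<phi> r2\<beta> by (simp add: Comp_Neg assoc)
  finally have c'': "Susp T u \<cdot> w' \<cdot> \<phi> = c''" by simp
  have "exact_triangle T Y S\<^sub>2 Z' (d\<^sub>1 \<cdot> i\<^sub>2) (v' \<cdot> q\<^sub>1 \<boxplus> h \<cdot> q\<^sub>2) (Susp T u \<cdot> w')"
    by (rule TR1_iso[OF tc, of _ _ _ _ _ _ "ident T Y" "ident T S\<^sub>2" \<phi>])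
      (use B1(1-15) B2(1-15) D D' E F gh \<phi> \<phi>c' c'' iso in
        \<open>auto simp: Hom_iff candidate_triangle_def triangle_map_def is_iso_ident\<close>)
  then show ?thesis using that[OF b2] d1i2 by simp
qed

text \<open>The projection \<open>q\<^sub>1\<close> turns the column into \<open>g\<close> and has
  cone the suspension of \<open>Z\<close>, by the rotated split triangle. The octahedron gives a
  triangle on \<open>Z'\<close>, \<open>Y''\<close> and that suspension, whose last map is minus the
  suspension of \<open>h\<close>; rotating back puts \<open>h\<close> first.\<close>

lemma column_row_octahedron:
  assumes b: "biproduct T Y' Z S j\<^sub>1 j\<^sub>2 q\<^sub>1 q\<^sub>2"
    and t: "exact_triangle T Y S Z' (j\<^sub>1 \<cdot> g \<boxplus> j\<^sub>2 \<cdot> (\<boxminus> v)) (k \<cdot> q\<^sub>1 \<boxplus> h \<cdot> q\<^sub>2) d"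
    and tg: "exact_triangle T Y Y' Y'' g g' g''"
    and v: "v \<in> Hom T Y Z" and k: "k \<in> Hom T Y' Z'" and h: "h \<in> Hom T Z Z'"
  obtains \<beta> where "exact_triangle T Z Z' Y'' h \<beta> (Susp T v \<cdot> g'')" "\<beta> \<cdot> k = g'" "g'' \<cdot> \<beta> = d"
proof -
  note B = biproductD[OF b] and D = exact_triangleD[OF t] and G = exact_triangleD[OF tg]
  let ?s = "j\<^sub>1 \<cdot> g \<boxplus> j\<^sub>2 \<cdot> (\<boxminus> v)" and ?r = "k \<cdot> q\<^sub>1 \<boxplus> h \<cdot> q\<^sub>2"
  have s: "q\<^sub>1 \<cdot> ?s = g" "q\<^sub>2 \<cdot> ?s = \<boxminus> v"
    using B v G by (simp_all add: Hom_iff Comp_Add assoc[symmetric])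
  have r: "?r \<cdot> j\<^sub>1 = k" "?r \<cdot> j\<^sub>2 = h"
    using B h k by (simp_all add: Hom_iff Add_Comp assoc)
  have "exact_triangle T S Y' (SuspO T Z) q\<^sub>1 (Zero T Y' (SuspO T Z)) (\<boxminus> Susp T j\<^sub>2)"
    using rotate[OF split_triangle[OF b]] .
  moreover have "exact_triangle T Y Y' Y'' (q\<^sub>1 \<cdot> ?s) g' g''" using tg s by simp
  ultimately obtain \<alpha> \<beta> \<gamma> where
    "octahedron T (?s, ?r, d) (q\<^sub>1, Zero T Y' (SuspO T Z), \<boxminus> Susp T j\<^sub>2) (g', g'') (\<alpha>, \<beta>, \<gamma>)"
    using TR4[OF t] by blast
  then have o: "exact_triangle T Z' Y'' (SuspO T Z) \<alpha> \<beta> \<gamma>" "\<alpha> \<cdot> ?r = g' \<cdot> q\<^sub>1" "g'' \<cdot> \<alpha> = d"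
    "\<gamma> = Susp T ?r \<cdot> (\<boxminus> Susp T j\<^sub>2)" "\<boxminus> Susp T j\<^sub>2 \<cdot> \<beta> = Susp T ?s \<cdot> g''"
    using D(6) G B(13,14) by (auto simp: octahedron_def)
  note E = exact_triangleD[OF o(1)]
  have "\<alpha> \<cdot> k = \<alpha> \<cdot> ?r \<cdot> j\<^sub>1"
    using r(1) D E B(1-15) by (simp add: assoc)
  also have "\<dots> = g'" using o(2) G B by (simp add: assoc)
  finally have \<alpha>: "\<alpha> \<cdot> k = g'" .
  have \<gamma>: "\<gamma> = \<boxminus> Susp T h"
    using o(4) r(2) D(4-6) B(1-15) by (simp add: Comp_Neg Susp_Comp[symmetric])
  \<comment> \<open>The octahedron determines \<beta> only after composition with minus the
    suspension of \<open>j\<^sub>2\<close>. Applying the suspension of \<open>q\<^sub>2\<close>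
    isolates it, and the sign cancels the one in \<open>q\<^sub>2 \<cdot> ?s = - v\<close>.\<close>
  have "\<beta> = Susp T (q\<^sub>2 \<cdot> j\<^sub>2) \<cdot> \<beta>" using B E by simp
  also have "\<dots> = \<boxminus> (Susp T q\<^sub>2 \<cdot> (\<boxminus> Susp T j\<^sub>2 \<cdot> \<beta>))"
    using B(1-15) E by (simp add: Susp_Comp assoc Neg_Comp Comp_Neg)
  also have "\<dots> = \<boxminus> (Susp T (q\<^sub>2 \<cdot> ?s) \<cdot> g'')"
    using B(1-15) D(1-3) G o(5) by (simp only: Susp_Comp assoc Susp_simps)
  also have "\<dots> = Susp T v \<cdot> g''"
    using s v G by (simp add: Hom_iff Susp_Neg Neg_Comp)
  finally have \<beta>: "\<beta> = Susp T v \<cdot> g''" .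
  have "candidate_triangle T Z Z' Y'' h \<alpha> \<beta>"
    using h E by (simp add: candidate_triangle_def Hom_iff)
  then have "exact_triangle T Z Z' Y'' h \<alpha> \<beta>" using TR2 o(1) \<gamma> by simp
  then show ?thesis using that \<alpha> o(3) \<beta> by simp
qed

section \<open>Assembling the two octahedra over an arbitrary cone of
  \<open>g \<cdot> u\<close>\<close>

lemma good_imp_Verdier_good:
  assumes t: "exact_triangle T X Y Z u v w" and t': "exact_triangle T X Y' Z' u' v' w'"
    and m: "triangle_map T (u, v, w) (u', v', w') (ident T X, g, h)"
    and good: "good T (u, v, w) (u', v', w') (ident T X, g, h)"
  shows "Verdier_good T (u, v, w) (u', v', w') (ident T X, g, h)"
proof -
  note D = exact_triangleD[OF t] and D' = exact_triangleD[OF t']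
  have gh: "g \<in> Arr T" "Dom T g = Y" "Cod T g = Y'" "h \<in> Arr T" "Dom T h = Z" "Cod T h = Z'"
    "g \<cdot> u = u'" "h \<cdot> v = v' \<cdot> g" "w' \<cdot> h = w"
    using m D D' by (auto simp: triangle_map_def Hom_iff)
  show ?thesis
    unfolding Verdier_good_def prod.case
  proof (intro allI impI)
    fix X'' f' f'' Y'' g' g'' A vt wt
    assume "exact_triangle T (Dom T (ident T X)) (Cod T (ident T X)) X'' (ident T X) f' f'' \<and>
      exact_triangle T (Dom T g) (Cod T g) Y'' g g' g'' \<and>
      exact_triangle T (Dom T u) (Cod T g) A (g \<cdot> u) vt wt"
    then have tf: "exact_triangle T X X X'' (ident T X) f' f''"
      and tg: "exact_triangle T Y Y' Y'' g g' g''"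
      and ta: "exact_triangle T X Y' A u' vt wt"
      using D gh by auto
    note Df = exact_triangleD[OF tf] and Dg = exact_triangleD[OF tg] and Da = exact_triangleD[OF ta]
    have f': "f' = Zero T X X''" and f'': "f'' = Zero T X'' (SuspO T X)"
      using exact_Comp_Zero[OF tf] Df by auto
    have "exact_triangle T X Y' A (u' \<cdot> ident T X) vt wt" using ta D' by simp
    then obtain \<alpha>\<^sub>2 \<beta>\<^sub>2 \<gamma>\<^sub>2 where
      o2: "octahedron T (ident T X, f', f'') (u', v', w') (vt, wt) (\<alpha>\<^sub>2, \<beta>\<^sub>2, \<gamma>\<^sub>2)"
      using TR4[OF tf t'] by blast
    then have o: "exact_triangle T X'' A Z' \<alpha>\<^sub>2 \<beta>\<^sub>2 \<gamma>\<^sub>2" "\<beta>\<^sub>2 \<cdot> vt = v'" "\<gamma>\<^sub>2 = Susp T f' \<cdot> w'"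
      "w' \<cdot> \<beta>\<^sub>2 = Susp T (ident T X) \<cdot> wt"
      using Df D' Da by (auto simp: octahedron_def)
    note Do = exact_triangleD[OF o(1)]
    \<comment> \<open>Since \<open>f' = 0\<close>, the identity of \<open>X''\<close> factors
      through \<open>f''\<close>, which is zero as well. Hence \<open>X''\<close> is a zero object
      and both outer maps around \<open>\<beta>\<^sub>2\<close> vanish.\<close>
    obtain n where n: "n \<in> Hom T (SuspO T X) X''" "n \<cdot> f'' = ident T X''"
      using weak_cokernel[OF rotate[OF tf], of "ident T X''" X''] Df f' by (auto simp: Hom_iff)
    then have "ident T X'' = Zero T X'' X''" using f'' Df by (simp add: Hom_iff)
    then have "\<alpha>\<^sub>2 = Zero T X'' A"
      using Comp_ident[of \<alpha>\<^sub>2 X''] Do by simp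
    moreover have "\<gamma>\<^sub>2 = Zero T Z' (SuspO T X'')"
      using o(3) f' Df D' by simp
    ultimately have "is_iso T \<beta>\<^sub>2" using second_map_iso[OF o(1)] by blast
    then obtain e where e: "e \<in> Hom T Z' A" "e \<cdot> \<beta>\<^sub>2 = ident T A" "\<beta>\<^sub>2 \<cdot> e = ident T Z'"
      using is_isoE[of \<beta>\<^sub>2 A Z'] Do by (auto simp: Hom_iff)
    have iso: "is_iso T e" using e Do by (intro is_isoI[of e Z' A \<beta>\<^sub>2]) (auto simp: Hom_iff)
    have w\<beta>: "w' \<cdot> \<beta>\<^sub>2 = wt" using o(4) D Da by simp
    obtain S j\<^sub>1 j\<^sub>2 q\<^sub>1 q\<^sub>2 where b: "biproduct T Y' Z S j\<^sub>1 j\<^sub>2 q\<^sub>1 q\<^sub>2" and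
      "exact_triangle T Y S Z' (j\<^sub>1 \<cdot> g \<boxplus> j\<^sub>2 \<cdot> (\<boxminus> v)) (v' \<cdot> q\<^sub>1 \<boxplus> h \<cdot> q\<^sub>2) (Susp T u \<cdot> w')"
      using column_row_triangle[OF t t' m good] .
    from column_row_octahedron[OF this tg] obtain \<beta> where
      \<beta>: "exact_triangle T Z Z' Y'' h \<beta> (Susp T v \<cdot> g'')" "\<beta> \<cdot> v' = g'" "g'' \<cdot> \<beta> = Susp T u \<cdot> w'"
      using D D' gh by (auto simp: Hom_iff)
    note Db = exact_triangleD[OF \<beta>(1)]
    have "\<beta> \<cdot> \<beta>\<^sub>2 \<cdot> e = \<beta>"
      using e Do Db by (simp add: Hom_iff assoc)
    \<comment> \<open>Transport along the inverse \<open>e\<close> of \<open>\<beta>\<^sub>2\<close>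
      replaces \<open>Z'\<close> by \<open>A\<close>. The maps obtained are the first octahedron,
      with \<open>\<alpha>\<^sub>1 = e \<cdot> h\<close>; its relations are checked one by one
      below.\<close>
    then have "exact_triangle T Z A Y'' (e \<cdot> h) (\<beta> \<cdot> \<beta>\<^sub>2) (Susp T v \<cdot> g'')"
      by (intro TR1_iso[OF \<beta>(1), of _ _ _ _ _ _ "ident T Z" e "ident T Y''"])
        (use e(1) Do Db iso in
          \<open>auto simp: Hom_iff candidate_triangle_def triangle_map_def is_iso_ident\<close>)
    moreover have "e \<cdot> h \<cdot> v = vt \<cdot> g"
    proof -
      \<comment> \<open>Here \<open>h \<cdot> v = v' \<cdot> g\<close>, and \<open>v'\<close> is
        rewritten as \<open>\<beta>\<^sub>2 \<cdot> vt\<close> so that \<open>e\<close> can cancel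
        \<open>\<beta>\<^sub>2\<close>.\<close>
      have "e \<cdot> h \<cdot> v = e \<cdot> (\<beta>\<^sub>2 \<cdot> vt \<cdot> g)"
        using e(1) gh D o(2) by (simp add: Hom_iff assoc)
      also have "\<dots> = e \<cdot> \<beta>\<^sub>2 \<cdot> (vt \<cdot> g)"
        using e(1) gh(1-6) Do Da by (simp add: Hom_iff assoc)
      finally show ?thesis using e gh(1-6) Da by simp
    qed
    moreover have "wt \<cdot> (e \<cdot> h) = w"
    proof -
      have "wt \<cdot> (e \<cdot> h) = w' \<cdot> (\<beta>\<^sub>2 \<cdot> e) \<cdot> h"
        using e(1) w\<beta>[symmetric] gh(1-6) Do D' by (simp add: Hom_iff assoc)
      then show ?thesis using e gh D' by simp
    qed
    moreover have "\<beta> \<cdot> \<beta>\<^sub>2 \<cdot> vt = g'"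
      using \<beta>(2) o(2) Db Do Da by (simp add: assoc)
    moreover have "g'' \<cdot> (\<beta> \<cdot> \<beta>\<^sub>2) = Susp T u \<cdot> wt"
    proof -
      have "g'' \<cdot> (\<beta> \<cdot> \<beta>\<^sub>2) = g'' \<cdot> \<beta> \<cdot> \<beta>\<^sub>2" using Db Do Dg by (simp add: assoc)
      also have "\<dots> = Susp T u \<cdot> wt" using \<beta>(3) D D' Do w\<beta> by (simp add: assoc)
      finally show ?thesis .
    qed
    ultimately have
      "octahedron T (u, v, w) (g, g', g'') (vt, wt) (e \<cdot> h, \<beta> \<cdot> \<beta>\<^sub>2, Susp T v \<cdot> g'')"
      using D Dg Da by (simp add: octahedron_def)
    \<comment> \<open>The factorization of \<open>h\<close> holds by the choice of
      \<open>\<alpha>\<^sub>1\<close>, as \<open>e\<close> is a right inverse of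
      \<open>\<beta>\<^sub>2\<close>.\<close>
    moreover have "h = \<beta>\<^sub>2 \<cdot> (e \<cdot> h)"
      using e gh(1-6) Do assoc[of h e \<beta>\<^sub>2] by (simp add: Hom_iff)
    ultimately show "\<exists>\<alpha>\<^sub>1 \<beta>\<^sub>1 \<gamma>\<^sub>1 \<alpha>\<^sub>2 \<beta>\<^sub>2 \<gamma>\<^sub>2.
        octahedron T (u, v, w) (g, g', g'') (vt, wt) (\<alpha>\<^sub>1, \<beta>\<^sub>1, \<gamma>\<^sub>1) \<and>
        octahedron T (ident T X, f', f'') (u', v', w') (vt, wt) (\<alpha>\<^sub>2, \<beta>\<^sub>2, \<gamma>\<^sub>2) \<and>
        h = \<beta>\<^sub>2 \<cdot> \<alpha>\<^sub>1"
      using o2 by blast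
  qed
qed

end

theorem corollary6p18:
  fixes T :: "('o, 'm, 'x) triangulated_category_scheme"
  assumes "triangulated_category T"
    and "exact_triangle T X Y Z u v w"
    and "exact_triangle T X Y' Z' u' v' w'"
    and "triangle_map T (u, v, w) (u', v', w') (ident T X, g, h)"
    and "good T (u, v, w) (u', v', w') (ident T X, g, h)"
  shows "Verdier_good T (u, v, w) (u', v', w') (ident T X, g, h)"
  using triangulated_category.good_imp_Verdier_good[OF assms] .

end
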